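(* Let $q\in\mathbb{C}$ with $0<|q|<1$, let $\alpha\ge 1$ be an integer and let $n\ge 0$ be an integer. Let $\mathcal{H}_n^{(\alpha)}(q)$ be the $(n+1)\times(n+1)$ generalized quantum Hilbert matrix $$\mathcal{H}_n^{(\alpha)}(q)=\left(\frac{[\alpha]_q}{[l+j+\alpha]_q}\right)_{0\le l,j\le n}.$$ Then $\mathcal{H}_n^{(\alpha)}(q)$ is invertible, and for all $0\le l,j\le n$ the $(l,j)$ entry of its inverse is $$\left(\mathcal{H}_n^{(\alpha)}(q)^{-1}\right)_{l,j}=(-1)^{l+j}\,\frac{[l+j+\alpha]_q}{[\alpha]_q}\binom{n+l+\alpha}{n-j}_q\binom{n+j+\alpha}{n-l}_q\binom{l+j+\alpha-1}{l}_q\binom{l+j+\alpha-1}{j}_q .$$ Furthermore, $$\det \mathcal{H}_n^{(\alpha)}(q)=[\alpha]_q^{\,n}\left(\prod_{k=1}^n [2k+\alpha]_q\binom{2k+\alpha-1}{k}_q^{2}\right)^{-1}.$$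
   Context: For $q\in\mathbb{C}\setminus\{0\}$ and an integer $m\ge 0$, the quantum integer is $$[m]_q=\frac{q^{m/2}-q^{-m/2}}{q^{1/2}-q^{-1/2}},$$ regarded as a holomorphic function of $q$ in the cut plane $\mathbb{C}\setminus\left]-\infty,0\right]$ (principal branch of $q^{1/2}$, with $q^{m/2}=(q^{1/2})^m$; $[m]_1=m$), and extended to $q\in\left]-\infty,0\right[$ by $[m]_q=\lim_{\varepsilon\to 0^+}[m]_{q+i\varepsilon}$ (i.e. $q^{1/2}=i\sqrt{|q|}$ for $q<0$). For $q\neq 0$ and $m\ge 1$, $[m]_q=0$ exactly when $q\ne 1$ and $q^m=1$; hence $[m]_q\neq 0$ for all $m\ge 1$ when $0<|q|<1$. For integers $0\le k\le m$, the quantum binomial coefficient is $$\binom{m}{k}_q=\prod_{j=1}^k\frac{[m-j+1]_q}{[j]_q},$$ where empty products are equal to $1$. Rows and columns of matrices are indexed by $0,1,\ldots,n$. *)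

theory Defs
  imports Complex_Main
    "Jordan_Normal_Form.Gauss_Jordan_Elimination"
    "Jordan_Normal_Form.Determinant"
begin

text \<open>The library's \<open>csqrt\<close> is the principal square root, with \<open>csqrt q = \<i> * sqrt \<bar>q\<bar>\<close> for real
  \<open>q < 0\<close>; this is the boundary value from the upper half plane, see \<open>quantum_int_tendsto_neg\<close>.
  For \<open>q \<noteq> 0\<close> the denominator vanishes only at \<open>q = 1\<close>, where the singularity is removable and
  the quotient is replaced by its limit \<open>m\<close>, see \<open>quantum_int_eq_sum\<close>.  The value at \<open>q = 0\<close>
  has no meaning.\<close>

definition quantum_int :: "complex \<Rightarrow> nat \<Rightarrow> complex" where
  "quantum_int q m =
     (if q = 1 then of_nat m
      else (csqrt q ^ m - inverse (csqrt q) ^ m) / (csqrt q - inverse (csqrt q)))"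

text \<open>Meant for \<open>k \<le> m\<close>, where the subtraction on \<open>nat\<close> does not truncate.\<close>

definition quantum_binomial :: "complex \<Rightarrow> nat \<Rightarrow> nat \<Rightarrow> complex" where
  "quantum_binomial q m k = (\<Prod>j=1..k. quantum_int q (m - j + 1) / quantum_int q j)"

definition quantum_hilbert_mat :: "complex \<Rightarrow> nat \<Rightarrow> nat \<Rightarrow> complex mat" where
  "quantum_hilbert_mat q \<alpha> n =
     mat (n + 1) (n + 1) (\<lambda>(l, j). quantum_int q \<alpha> / quantum_int q (l + j + \<alpha>))"

lemma quantum_int_eq_sum:
  assumes "q \<noteq> 0"
  shows "quantum_int q m = (\<Sum>i<m. csqrt q ^ i * inverse (csqrt q) ^ (m - Suc i))"
proof (cases "q = 1")
  case True
  then show ?thesis by (simp add: quantum_int_def)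
next
  case False
  let ?s = "csqrt q"
  have s0: "?s \<noteq> 0" using assms by simp
  have ne: "?s - inverse ?s \<noteq> 0"
  proof
    assume "?s - inverse ?s = 0"
    then have "?s * ?s = 1" using s0 by (simp add: field_simps)
    then show False using False by (metis power2_csqrt power2_eq_square)
  qed
  have "?s ^ m - inverse ?s ^ m =
      (?s - inverse ?s) * (\<Sum>i<m. ?s ^ i * inverse ?s ^ (m - Suc i))"
    using power_diff_sumr2[of ?s m "inverse ?s"] by (simp only: mult.commute[of "inverse ?s ^ _"])
  then show ?thesis using False ne by (simp add: quantum_int_def)
qed

lemma quantum_int_tendsto_neg:
  fixes x :: real
  assumes "x < 0"
  shows "((\<lambda>e. quantum_int (Complex x e) m) \<longlongrightarrow> quantum_int (of_real x) m) (at_right 0)"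
proof -
  let ?c = "\<lambda>e. Complex (sqrt ((cmod (Complex x e) + x) / 2)) (sqrt ((cmod (Complex x e) - x) / 2))"
  have eq: "csqrt (Complex x e) = ?c e" if "e \<ge> 0" for e
    using that by (auto simp: complex_eq_iff sgn_if)
  have cont: "(?c \<longlongrightarrow> ?c 0) (at_right 0)"
    unfolding cmod_def by (intro tendsto_Complex tendsto_intros) auto
  have lim: "((\<lambda>e. csqrt (Complex x e)) \<longlongrightarrow> csqrt (Complex x 0)) (at_right 0)"
    by (rule Lim_transform_eventually[OF cont[folded eq[of 0, simplified]]])
       (auto simp: eventually_at_right_less eq intro!: eventually_mono[OF eventually_at_right_less[of 0]])
  have nz: "csqrt (Complex x 0) \<noteq> 0" using assms by (auto simp: complex_eq_iff)
  have nq: "Complex x e \<noteq> 0" for e using assms by (auto simp: complex_eq_iff)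
  have "((\<lambda>e. quantum_int (Complex x e) m) \<longlongrightarrow> quantum_int (Complex x 0) m) (at_right 0)"
    unfolding quantum_int_eq_sum[OF nq] by (intro tendsto_intros lim nz)
  then show ?thesis by (simp add: complex_of_real_def)
qed

end

theory Submission
  imports Defs
begin

text \<open>With \<open>s\<close> a square root of \<open>q\<close>, the nodes \<open>x\<^sub>l = s\<^bsup>2l\<^esup>\<close> and \<open>y\<^sub>j = s\<^bsup>-2(j+\<alpha>)\<^esup>\<close> satisfy
  \<open>x\<^sub>l - y\<^sub>j = s\<^bsup>l-j-\<alpha>\<^esup> (s - s\<^bsup>-1\<^esup>) [l+j+\<alpha>]\<close>, so the quantum Hilbert matrix is a diagonal rescaling of
  the Cauchy matrix of these nodes.  The inverse of a Cauchy matrix is read off from Lagrange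
  interpolation, and all powers of \<open>s\<close> cancel when it is rewritten in terms of quantum integers.
  By Cramer's rule the last diagonal entry of the inverse is the quotient of two consecutive
  determinants, which gives the determinant by induction.\<close>

section \<open>Cauchy matrices\<close>

lemma degree_prod_linear_le:
  fixes c :: "'b \<Rightarrow> 'a::comm_semiring_1" and d :: "'b \<Rightarrow> 'a"
  shows "degree (\<Prod>i\<in>I. [:c i, d i:]) \<le> card I"
proof (induction I rule: infinite_finite_induct)
  case (insert i I)
  have "degree ([:c i, d i:] * (\<Prod>i\<in>I. [:c i, d i:])) \<le> 1 + card I"
    by (rule order.trans[OF degree_mult_le add_mono[OF _ insert.IH]]) simp
  then show ?case using insert.hyps by simp
qed auto

text \<open>The interpolant \<open>r\<close> and \<open>p\<close> both have degree below
  \<open>card I\<close> and agree at the \<open>card I\<close> distinct nodes, so they are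
  equal.\<close>

lemma lagrange_interpolation:
  fixes y :: "'b \<Rightarrow> 'a::field"
  assumes fin: "finite I" and inj: "inj_on y I" and deg: "degree p < card I"
  shows "(\<Sum>j\<in>I. poly p (y j) * (\<Prod>m\<in>I - {j}. (t - y m) / (y j - y m))) = poly p t"
proof -
  define L where "L j = (\<Prod>m\<in>I - {j}. [:- y m / (y j - y m), 1 / (y j - y m):])" for j
  define r where "r = (\<Sum>j\<in>I. smult (poly p (y j)) (L j))"
  have L: "poly (L j) u = (\<Prod>m\<in>I - {j}. (u - y m) / (y j - y m))" for j u
    by (simp add: L_def poly_prod diff_divide_distrib)
  have degL: "degree (L j) \<le> card I - 1" if "j \<in> I" for j
    using degree_prod_linear_le[of _ _ "I - {j}"] that fin by (simp add: L_def)
  have L_node: "poly (L j) (y i) = (if i = j then 1 else 0)" if "i \<in> I" "j \<in> I" for i j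
  proof (cases "i = j")
    case True
    have "y j - y m \<noteq> 0" if "m \<in> I - {j}" for m
      using that \<open>j \<in> I\<close> inj by (auto dest: inj_onD)
    then show ?thesis using True by (simp add: L)
  next
    case False
    then have "\<exists>m\<in>I - {j}. (y i - y m) / (y j - y m) = 0"
      using that by (intro bexI[of _ i]) auto
    then show ?thesis using False fin by (simp add: L prod_zero)
  qed
  have "r = p"
  proof (rule poly_eqI_degree[of "y ` I"])
    have "degree r \<le> card I - 1"
      unfolding r_def using fin degL
      by (intro degree_sum_le) (auto intro: order.trans[OF degree_smult_le])
    then show "degree r < card (y ` I)" using deg inj by (simp add: card_image)
    show "degree p < card (y ` I)" using deg inj by (simp add: card_image)
  next
    fix u assume "u \<in> y ` I"
    then obtain i where i: "i \<in> I" "u = y i" by auto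
    have "poly r u = (\<Sum>j\<in>I. if i = j then poly p (y j) else 0)"
      unfolding r_def poly_sum i(2) by (intro sum.cong) (auto simp: L_node i)
    then show "poly r u = poly p u" using i fin by simp
  qed
  then have "poly p t = poly r t" by simp
  then show ?thesis by (simp add: r_def poly_sum L)
qed

text \<open>This multiplies the Cauchy matrix \<open>1 / (x l - y j)\<close> by its inverse, whose
  \<open>(j, k)\<close> entry is \<open>x k - y j\<close> times the two products. For fixed
  \<open>l\<close> and \<open>k\<close>, the quotient and the first product together are the value
  at \<open>y j\<close> of a polynomial \<open>p\<close> of degree below \<open>card I\<close>. The
  sum therefore interpolates \<open>p\<close> at the nodes \<open>y\<close> and returns its value at
  \<open>x k\<close>.\<close>

lemma cauchy_inverse:
  fixes x y :: "'b \<Rightarrow> 'a::field"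
  assumes fin: "finite I" and injx: "inj_on x I" and injy: "inj_on y I"
    and xy: "\<And>i j. i \<in> I \<Longrightarrow> j \<in> I \<Longrightarrow> x i \<noteq> y j" and l: "l \<in> I" and k: "k \<in> I"
  shows "(\<Sum>j\<in>I. (x k - y j) / (x l - y j) * (\<Prod>m\<in>I - {k}. (y j - x m) / (x k - x m))
            * (\<Prod>m\<in>I - {j}. (x k - y m) / (y j - y m))) = (if l = k then 1 else 0)"
proof -
  define d where "d m = x k - x m" for m
  \<comment> \<open>For \<open>l = k\<close> the quotient is \<open>1\<close>, and \<open>p\<close>
    is the Lagrange basis polynomial of the nodes \<open>x\<close>. Otherwise the factor for
    \<open>m = l\<close> cancels against \<open>x l - y j\<close>, leaving \<open>- 1 / d l\<close>,
    and the surviving factor \<open>x k - t\<close> makes \<open>p\<close> vanish at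
    \<open>x k\<close>.\<close>
  define p where "p = (if l = k then (\<Prod>m\<in>I - {k}. [:- x m / d m, 1 / d m:])
     else [:x k, -1:] * smult (- 1 / d l) (\<Prod>m\<in>I - {k} - {l}. [:- x m / d m, 1 / d m:]))"
  have pos: "card I > 0" using fin k by (auto simp: card_gt_0_iff)
  have p_node: "poly p (y j) = (x k - y j) / (x l - y j) * (\<Prod>m\<in>I - {k}. (y j - x m) / (x k - x m))"
    if j: "j \<in> I" for j
  proof (cases "l = k")
    case True
    then show ?thesis using xy[OF k j]
      by (simp add: p_def d_def poly_prod diff_divide_distrib)
  next
    case False
    have "(\<Prod>m\<in>I - {k}. (y j - x m) / (x k - x m))
        = (y j - x l) / (x k - x l) * (\<Prod>m\<in>I - {k} - {l}. (y j - x m) / (x k - x m))"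
      using False l fin by (intro prod.remove) auto
    moreover have "(y j - x l) / (x l - y j) = -1"
      using xy[OF l j] by (simp add: divide_eq_eq)
    ultimately show ?thesis using False xy[OF l j]
      by (simp add: p_def d_def poly_prod diff_divide_distrib[symmetric])
         (simp add: divide_simps; simp add: algebra_simps)
  qed
  have deg: "degree p < card I"
  proof (cases "l = k")
    case True
    have "degree p \<le> card (I - {k})"
      using True degree_prod_linear_le by (simp add: p_def)
    then show ?thesis using pos k fin by simp
  next
    case False
    have "card (I - {k} - {l}) = card I - 2" using False k l fin by simp
    moreover have "degree p \<le> 1 + card (I - {k} - {l})"
      unfolding p_def if_not_P[OF False]
      by (rule order.trans[OF degree_mult_le
            add_mono[OF _ order.trans[OF degree_smult_le degree_prod_linear_le]]]) simp
    moreover have "card I \<ge> 2"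
      using False k l fin card_mono[of I "{k, l}"] by simp
    ultimately show ?thesis by simp
  qed
  have "poly p (x k) = (if l = k then 1 else 0)"
  proof (cases "l = k")
    case True
    have "x k - x m \<noteq> 0" if "m \<in> I - {k}" for m
      using that k injx by (auto dest: inj_onD)
    then show ?thesis using True
      by (simp add: p_def d_def poly_prod diff_divide_distrib[symmetric])
  qed (simp add: p_def)
  then show ?thesis
    using lagrange_interpolation[OF fin injy deg, of "x k"] by (simp add: p_node)
qed

section \<open>Quantum integers for a base that is not a root of unity\<close>

text \<open>Here \<open>s\<close> stands for a square root of \<open>q\<close>, so that half-integer
  powers of \<open>q\<close> become integer powers and no branch has to be chosen.
  \<open>not_root\<close> makes the nodes distinct and the quantum integers of nonzero index
  invertible.\<close>

locale quantum_base =
  fixes s :: "'a::field"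
  assumes s_nz: "s \<noteq> 0" and not_root: "\<And>m. m > 0 \<Longrightarrow> s ^ m \<noteq> 1"
begin

text \<open>The index is an integer because node differences lead to indices of either sign.\<close>

definition qn :: "int \<Rightarrow> 'a" where
  "qn z = (s powi z - s powi (- z)) / (s - inverse s)"

definition qfact :: "nat \<Rightarrow> 'a" where
  "qfact n = (\<Prod>i=1..n. qn (int i))"

definition qbinom :: "nat \<Rightarrow> nat \<Rightarrow> 'a" where
  "qbinom m k = (\<Prod>j=1..k. qn (int (m - j + 1)) / qn (int j))"

definition hilbert_inv :: "nat \<Rightarrow> nat \<Rightarrow> nat \<Rightarrow> nat \<Rightarrow> 'a" where
  "hilbert_inv \<alpha> n l j = (-1) ^ (l + j) * (qn (int (l + j + \<alpha>)) / qn (int \<alpha>))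
     * qbinom (n + l + \<alpha>) (n - j) * qbinom (n + j + \<alpha>) (n - l)
     * qbinom (l + j + \<alpha> - 1) l * qbinom (l + j + \<alpha> - 1) j"

lemma powi_ne_1: "z \<noteq> 0 \<Longrightarrow> s powi z \<noteq> 1"
  using not_root[of "nat z"] not_root[of "nat (- z)"]
  by (cases "z > 0") (auto simp: power_int_def power_inverse)

lemma powi_inj: "s powi a = s powi b \<longleftrightarrow> a = b"
proof
  assume "s powi a = s powi b"
  then have "s powi (a - b) = 1" using s_nz by (simp add: power_int_diff)
  then show "a = b" using powi_ne_1[of "a - b"] by auto
qed simp

lemma denom_nz: "s - inverse s \<noteq> 0"
  using powi_inj[of 1 "-1"] by (simp add: power_int_minus)

lemma qn_nz: "z \<noteq> 0 \<Longrightarrow> qn z \<noteq> 0"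
  using denom_nz powi_inj[of z "- z"] by (simp add: qn_def)

lemma qn_minus: "qn (- z) = - qn z"
  by (simp add: qn_def diff_divide_distrib)

text \<open>Factoring out the midpoint power \<open>s powi (a + b)\<close> leaves the numerator of
  \<open>qn (a - b)\<close>. This turns every node difference into a quantum integer times a power
  of \<open>s\<close>.\<close>

lemma powi_diff: "s powi (2 * a) - s powi (2 * b) = s powi (a + b) * (s - inverse s) * qn (a - b)"
proof -
  have p: "s powi (a + b) * s powi (a - b) = s powi (2 * a)"
    "s powi (a + b) * s powi (- (a - b)) = s powi (2 * b)"
    using s_nz by (simp_all flip: power_int_add)
  have q: "(s - inverse s) * qn (a - b) = s powi (a - b) - s powi (- (a - b))"
    using denom_nz by (simp add: qn_def)
  show ?thesis unfolding mult.assoc q by (simp only: right_diff_distrib p)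
qed

lemma powi_diff_neg:
  "s powi (2 * int i) - s powi (2 * (- int c)) = s powi (int i - int c) * (s - inverse s) * qn (int (i + c))"
proof -
  have "int i + - int c = int i - int c" "int i - - int c = int (i + c)" by simp_all
  then show ?thesis by (simp only: powi_diff)
qed

section \<open>Quantum factorials and products of quantum integers\<close>

lemma qfact_nz: "qfact n \<noteq> 0"
  by (auto simp: qfact_def qn_nz)

lemma qfact_Suc: "qfact (Suc n) = qfact n * qn (int (Suc n))"
  by (simp add: qfact_def)

text \<open>This lets the four binomials of the inverse be compared with the factorials that come
  out of the Lagrange products.\<close>

lemma qbinom_eq_qfact:
  assumes "k \<le> m"
  shows "qbinom m k = qfact m / (qfact k * qfact (m - k))"
  using assms
proof (induction k)
  case 0
  then show ?case using qfact_nz by (simp add: qbinom_def qfact_def)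
next
  case (Suc k)
  have "m - k = Suc (m - Suc k)" using Suc.prems by simp
  then have f: "qfact (m - k) = qfact (m - Suc k) * qn (int (m - k))"
    by (metis qfact_Suc)
  have "qbinom m (Suc k) = qbinom m k * (qn (int (m - k)) / qn (int (Suc k)))"
    using Suc.prems by (simp add: qbinom_def Suc_diff_Suc flip: Suc_diff_le)
  then show ?case
    using Suc f qfact_nz qn_nz[of "int (m - k)"] by (simp add: qfact_Suc)
qed

lemma prod_qn_shift: "(\<Prod>m\<le>n. qn (int (m + Suc c))) * qfact c = qfact (n + Suc c)"
  by (induction n) (simp_all add: qfact_Suc algebra_simps)

lemma prod_qn_upto: "(\<Prod>m<k. qn (int k - int m)) = qfact k"
  unfolding qfact_def
  by (rule prod.reindex_bij_witness[of _ "\<lambda>i. k - i" "\<lambda>i. k - i"]) (auto simp: of_nat_diff)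

text \<open>The indices below \<open>k\<close> give \<open>qfact k\<close>. The \<open>n - k\<close>
  indices above \<open>k\<close> give \<open>qfact (n - k)\<close> and one sign each, as
  \<open>qn\<close> is odd.\<close>

lemma prod_qn_diff:
  assumes "k \<le> n"
  shows "(\<Prod>m\<in>{..n} - {k}. qn (int k - int m)) = (-1) ^ (n - k) * qfact k * qfact (n - k)"
  using assms
proof (induction n rule: dec_induct)
  case base
  have "{..k} - {k} = {..<k}" by auto
  then show ?case by (simp add: prod_qn_upto) (simp add: qfact_def)
next
  case (step n)
  have "{..Suc n} - {k} = insert (Suc n) ({..n} - {k})" using step.hyps by auto
  moreover have "qn (int k - int (Suc n)) = - qn (int (Suc (n - k)))"
    using step.hyps by (simp add: of_nat_diff diff_diff_eq algebra_simps flip: qn_minus)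
  ultimately show ?case using step by (simp add: Suc_diff_le qfact_Suc)
qed

text \<open>Each factor of the first product carries \<open>- inverse e\<close>, each factor of the
  second carries \<open>e\<close>, and both products have \<open>n\<close> factors, so all powers of
  \<open>s\<close> cancel. The remaining factorials regroup into the four binomials.\<close>

lemma lagrange_product_eq:
  assumes "j \<le> n" "k \<le> n" "1 \<le> \<alpha>"
  defines "x \<equiv> \<lambda>m. s powi (2 * int m)" and "y \<equiv> \<lambda>m. s powi (2 * (- int (m + \<alpha>)))"
  shows "qn (int (j + k + \<alpha>)) / qn (int \<alpha>) * (\<Prod>m\<in>{..n} - {k}. (y j - x m) / (x k - x m))
            * (\<Prod>m\<in>{..n} - {j}. (x k - y m) / (y j - y m)) = hilbert_inv \<alpha> n j k"
proof -
  define e where "e = s powi int (j + k + \<alpha>)"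
  define a where "a = j + k + \<alpha>"
  have e_nz: "e \<noteq> 0" using s_nz by (simp add: e_def)
  have card: "card ({..n} - {i}) = n" if "i \<le> n" for i using that by simp
  \<comment> \<open>The product over all \<open>m \<le> n\<close> is a quotient of factorials by
    \<open>prod_qn_shift\<close>; the factor for \<open>m = i\<close> is then divided out.\<close>
  have P: "(\<Prod>m\<in>{..n} - {i}. qn (int (m + i' + \<alpha>)))
      = qfact (n + i' + \<alpha>) / (qfact (i' + \<alpha> - 1) * qn (int (i + i' + \<alpha>)))" if "i \<le> n" for i i'
  proof -
    have "(\<Prod>m\<le>n. qn (int (m + i' + \<alpha>))) * qfact (i' + \<alpha> - 1) = qfact (n + i' + \<alpha>)"
      using prod_qn_shift[where n = n and c = "i' + \<alpha> - 1"] assms(3) by (simp add: add.assoc)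
    moreover have "(\<Prod>m\<le>n. qn (int (m + i' + \<alpha>)))
        = qn (int (i + i' + \<alpha>)) * (\<Prod>m\<in>{..n} - {i}. qn (int (m + i' + \<alpha>)))"
      using that by (intro prod.remove) auto
    moreover have "qn (int (i + i' + \<alpha>)) \<noteq> 0" using assms(3) by (intro qn_nz) simp
    ultimately show ?thesis using qfact_nz[of "i' + \<alpha> - 1"] by (simp add: field_simps)
  qed
  have xy: "x i - y m = s powi (int i - int (m + \<alpha>)) * (s - inverse s) * qn (int (i + m + \<alpha>))" for i m
    unfolding x_def y_def powi_diff_neg by (simp only: add.assoc)
  \<comment> \<open>The prefactor does not depend on \<open>m\<close>, so it leaves the product as
    an \<open>n\<close>-th power. At \<open>m = k\<close> both sides are \<open>0\<close>, since
    division by zero gives \<open>0\<close> and \<open>qn 0 = 0\<close>.\<close>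
  have A1: "(y j - x m) / (x k - x m)
      = - inverse e * (qn (int (m + j + \<alpha>)) / qn (int k - int m))" for m
  proof -
    have "y j - x m = - (s powi (int m - int (j + \<alpha>)) * (s - inverse s) * qn (int (m + j + \<alpha>)))"
      using xy[of m j] by (metis minus_diff_eq)
    moreover have "x k - x m = s powi (int k + int m) * (s - inverse s) * qn (int k - int m)"
      unfolding x_def by (rule powi_diff)
    moreover have "int m - int (j + \<alpha>) = - int (j + k + \<alpha>) + (int k + int m)" by simp
    then have "s powi (int m - int (j + \<alpha>)) = inverse e * s powi (int k + int m)"
      unfolding e_def power_int_minus[symmetric] using s_nz by (metis power_int_add)
    ultimately show ?thesis using denom_nz s_nz by simp
  qed
  have B1: "(x k - y m) / (y j - y m)
      = e * (qn (int (m + k + \<alpha>)) / (- qn (int j - int m)))" for m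
  proof -
    have "- int (j + \<alpha>) - - int (m + \<alpha>) = - (int j - int m)" by simp
    then have "y j - y m = s powi (- int (j + \<alpha>) + - int (m + \<alpha>)) * (s - inverse s) * (- qn (int j - int m))"
      unfolding y_def powi_diff by (simp only: qn_minus)
    moreover have "int k - int (m + \<alpha>) = int (j + k + \<alpha>) + (- int (j + \<alpha>) + - int (m + \<alpha>))" by simp
    then have "s powi (int k - int (m + \<alpha>)) = e * s powi (- int (j + \<alpha>) + - int (m + \<alpha>))"
      unfolding e_def using s_nz by (metis power_int_add)
    ultimately show ?thesis
      using xy[of k m, unfolded add.commute[of k m]] denom_nz s_nz by (simp del: of_nat_add)
  qed
  have a: "k + j + \<alpha> = a" "j + k + \<alpha> = a" by (simp_all add: a_def)
  have A: "(\<Prod>m\<in>{..n} - {k}. (y j - x m) / (x k - x m)) = (- inverse e) ^ n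
      * (qfact (n + j + \<alpha>) / (qfact (j + \<alpha> - 1) * qn (int a))
         / ((-1) ^ (n - k) * qfact k * qfact (n - k)))"
    unfolding A1 prod.distrib prod_dividef prod_constant card[OF assms(2)] P[OF assms(2)]
      prod_qn_diff[OF assms(2)] a ..
  have B: "(\<Prod>m\<in>{..n} - {j}. (x k - y m) / (y j - y m)) = e ^ n
      * (qfact (n + k + \<alpha>) / (qfact (k + \<alpha> - 1) * qn (int a))
         / ((-1) ^ n * ((-1) ^ (n - j) * qfact j * qfact (n - j))))"
    unfolding B1 prod.distrib prod_dividef prod_uminus prod_constant card[OF assms(1)] P[OF assms(1)]
      prod_qn_diff[OF assms(1)] a ..
  \<comment> \<open>The two exponents add up to \<open>2 * n - (j + k)\<close>.\<close>
  have "even ((n - k) + (n - j)) \<longleftrightarrow> even (j + k)" using assms(1,2) by auto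
  then have sign: "(-1::'a) ^ (n - k) * (-1) ^ (n - j) = (-1) ^ (j + k)"
    unfolding power_add[symmetric] by (simp only: minus_one_power_iff)
  \<comment> \<open>The sign left here cancels the \<open>(-1) ^ n\<close> in the denominator of
    \<open>B\<close>, which stems from the minus sign in \<open>B1\<close>.\<close>
  have cancel: "(- inverse e) ^ n * e ^ n = (-1) ^ n"
    using e_nz by (simp flip: power_mult_distrib)
  \<comment> \<open>The first two binomials have \<open>qfact a\<close> in the denominator, the last
    two \<open>qfact (a - 1)\<close> in the numerator. Together they leave the factor
    \<open>(qn (int a))\<^sup>2\<close> in the denominator of \<open>F\<close>.\<close>
  have "a = Suc (a - 1)" using assms(3) by (simp add: a_def)
  then have fact_a: "qfact a = qfact (a - 1) * qn (int a)" by (metis qfact_Suc)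
  have b1: "qbinom (n + j + \<alpha>) (n - k) = qfact (n + j + \<alpha>) / (qfact (n - k) * qfact a)"
    using assms(2) by (subst qbinom_eq_qfact) (auto simp: a_def intro!: arg_cong[of _ _ qfact])
  have b2: "qbinom (n + k + \<alpha>) (n - j) = qfact (n + k + \<alpha>) / (qfact (n - j) * qfact a)"
    using assms(1) by (subst qbinom_eq_qfact) (auto simp: a_def intro!: arg_cong[of _ _ qfact])
  have b3: "qbinom (a - 1) j = qfact (a - 1) / (qfact j * qfact (k + \<alpha> - 1))"
    using assms(3) by (subst qbinom_eq_qfact) (auto simp: a_def intro!: arg_cong[of _ _ qfact])
  have b4: "qbinom (a - 1) k = qfact (a - 1) / (qfact k * qfact (j + \<alpha> - 1))"
    using assms(3) by (subst qbinom_eq_qfact) (auto simp: a_def intro!: arg_cong[of _ _ qfact])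
  have nz: "qn (int a) \<noteq> 0" "qn (int \<alpha>) \<noteq> 0" using assms(3) by (auto simp: a_def intro!: qn_nz)
  define F where "F = qfact (n + j + \<alpha>) * qfact (n + k + \<alpha>)
    / (qfact (j + \<alpha> - 1) * qfact (k + \<alpha> - 1) * qfact j * qfact k * qfact (n - j) * qfact (n - k)
       * (qn (int a))\<^sup>2)"
  have "(\<Prod>m\<in>{..n} - {k}. (y j - x m) / (x k - x m)) * (\<Prod>m\<in>{..n} - {j}. (x k - y m) / (y j - y m))
      = ((- inverse e) ^ n * e ^ n) / ((-1) ^ n * ((-1) ^ (n - k) * (-1) ^ (n - j))) * F"
    unfolding A B F_def power2_eq_square by (simp add: mult_ac)
  also have "\<dots> = (-1) ^ (j + k) * F"
    unfolding cancel sign by (simp add: divide_inverse power_inverse[symmetric])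
  finally have "qn (int a) / qn (int \<alpha>) * (\<Prod>m\<in>{..n} - {k}. (y j - x m) / (x k - x m))
      * (\<Prod>m\<in>{..n} - {j}. (x k - y m) / (y j - y m)) = qn (int a) / qn (int \<alpha>) * ((-1) ^ (j + k) * F)"
    by (simp only: mult.assoc)
  also have "\<dots> = hilbert_inv \<alpha> n j k"
    unfolding hilbert_inv_def a_def[symmetric] b1 b2 b3 b4 F_def
    using nz qfact_nz[of "a - 1"] by (simp add: fact_a power2_eq_square mult_ac)
  finally show ?thesis unfolding a_def .
qed

text \<open>The Hilbert and Cauchy matrices differ by diagonal factors, which contribute only
  \<open>s powi (l - k)\<close> to the sum. This power is \<open>1\<close> for \<open>l = k\<close>
  and multiplies a vanishing sum otherwise.\<close>

lemma hilbert_inverse_sum: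
  assumes "l \<le> n" "k \<le> n" "1 \<le> \<alpha>"
  shows "(\<Sum>j\<le>n. qn (int \<alpha>) / qn (int (l + j + \<alpha>)) * hilbert_inv \<alpha> n j k) = (if l = k then 1 else 0)"
proof -
  define x where "x m = s powi (2 * int m)" for m
  define y where "y m = s powi (2 * (- int (m + \<alpha>)))" for m
  let ?P = "\<lambda>j. (\<Prod>m\<in>{..n} - {k}. (y j - x m) / (x k - x m))
                 * (\<Prod>m\<in>{..n} - {j}. (x k - y m) / (y j - y m))"
  have xy: "x i - y j = s powi (int i - int (j + \<alpha>)) * (s - inverse s) * qn (int (i + j + \<alpha>))" for i j
    unfolding x_def y_def powi_diff_neg by (simp only: add.assoc)
  \<comment> \<open>The powers of \<open>s\<close> in \<open>x k - y j\<close> and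
    \<open>x l - y j\<close> have a quotient independent of \<open>j\<close>, and
    \<open>qn (int \<alpha>)\<close> cancels between the two matrix entries.\<close>
  have summand: "qn (int \<alpha>) / qn (int (l + j + \<alpha>)) * hilbert_inv \<alpha> n j k
      = s powi (int l - int k) * ((x k - y j) / (x l - y j) * ?P j)" if "j \<le> n" for j
  proof -
    have "int l - int (j + \<alpha>) = (int l - int k) + (int k - int (j + \<alpha>))" by simp
    then have "s powi (int l - int (j + \<alpha>)) = s powi (int l - int k) * s powi (int k - int (j + \<alpha>))"
      using s_nz by (metis power_int_add)
    then have q: "s powi (int l - int k) * ((x k - y j) / (x l - y j))
        = qn (int (j + k + \<alpha>)) / qn (int (l + j + \<alpha>))"
      unfolding xy using s_nz denom_nz by (simp add: add_ac)
    have "hilbert_inv \<alpha> n j k = qn (int (j + k + \<alpha>)) / qn (int \<alpha>) * ?P j"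
      using lagrange_product_eq[OF that assms(2,3)] by (simp add: x_def y_def mult.assoc)
    moreover have "qn (int \<alpha>) \<noteq> 0" using assms(3) by (intro qn_nz) simp
    ultimately show ?thesis unfolding mult.assoc[symmetric] q by simp
  qed
  have "(\<Sum>j\<le>n. qn (int \<alpha>) / qn (int (l + j + \<alpha>)) * hilbert_inv \<alpha> n j k)
      = s powi (int l - int k) * (\<Sum>j\<le>n. (x k - y j) / (x l - y j) * ?P j)"
    unfolding sum_distrib_left by (intro sum.cong refl summand) simp
  also have "(\<Sum>j\<le>n. (x k - y j) / (x l - y j) * ?P j) = (if l = k then 1 else 0)"
    unfolding mult.assoc[symmetric] using assms
    by (intro cauchy_inverse) (auto simp: inj_on_def x_def y_def powi_inj)
  finally show ?thesis by auto
qed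

section \<open>The quantum Hilbert matrix\<close>

definition hilbert :: "nat \<Rightarrow> nat \<Rightarrow> 'a mat" where
  "hilbert \<alpha> n = mat (n + 1) (n + 1) (\<lambda>(l, j). qn (int \<alpha>) / qn (int (l + j + \<alpha>)))"

definition hilbert_inv_mat :: "nat \<Rightarrow> nat \<Rightarrow> 'a mat" where
  "hilbert_inv_mat \<alpha> n = mat (n + 1) (n + 1) (\<lambda>(l, j). hilbert_inv \<alpha> n l j)"

lemma hilbert_carrier [simp]:
  "hilbert \<alpha> n \<in> carrier_mat (n + 1) (n + 1)" "hilbert_inv_mat \<alpha> n \<in> carrier_mat (n + 1) (n + 1)"
  by (simp_all add: hilbert_def hilbert_inv_mat_def)

lemma hilbert_mult_inv:
  assumes "1 \<le> \<alpha>"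
  shows "hilbert \<alpha> n * hilbert_inv_mat \<alpha> n = 1\<^sub>m (n + 1)"
proof (rule eq_matI)
  fix l k assume "l < dim_row (1\<^sub>m (n + 1) :: 'a mat)" "k < dim_col (1\<^sub>m (n + 1) :: 'a mat)"
  then have lk: "l \<le> n" "k \<le> n" by simp_all
  have "{0..<Suc n} = {..n}" by auto
  then show "(hilbert \<alpha> n * hilbert_inv_mat \<alpha> n) $$ (l, k) = 1\<^sub>m (n + 1) $$ (l, k)"
    using hilbert_inverse_sum[OF lk assms] lk
    by (simp add: hilbert_def hilbert_inv_mat_def scalar_prod_def)
qed (simp_all add: hilbert_def hilbert_inv_mat_def)

lemma hilbert_inv_mult:
  assumes "1 \<le> \<alpha>"
  shows "hilbert_inv_mat \<alpha> n * hilbert \<alpha> n = 1\<^sub>m (n + 1)"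
  using mat_mult_left_right_inverse[OF hilbert_carrier hilbert_mult_inv[OF assms]] .

lemma hilbert_invertible:
  assumes "1 \<le> \<alpha>"
  shows "invertible_mat (hilbert \<alpha> n)"
  unfolding invertible_mat_def inverts_mat_def
  using hilbert_mult_inv[OF assms] hilbert_inv_mult[OF assms]
  by (auto simp: hilbert_def hilbert_inv_mat_def intro!: exI[of _ "hilbert_inv_mat \<alpha> n"])

text \<open>\<open>mat_inverse\<close> returns \<open>None\<close> only for a matrix that is not a
  unit, which the explicit inverse excludes. Any matrix it does return is an inverse, hence equal to
  the explicit one by uniqueness.\<close>

lemma mat_inverse_hilbert:
  assumes "1 \<le> \<alpha>"
  shows "mat_inverse (hilbert \<alpha> n) = Some (hilbert_inv_mat \<alpha> n)"
proof (cases "mat_inverse (hilbert \<alpha> n)")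
  case None
  have "hilbert \<alpha> n \<in> Units (ring_mat TYPE('a) (n + 1) ())"
    using hilbert_mult_inv[OF assms] hilbert_inv_mult[OF assms]
    by (auto simp: Units_def ring_mat_simps simp del: One_nat_def add_Suc_right intro!: bexI[of _ "hilbert_inv_mat \<alpha> n"])
  then show ?thesis using mat_inverse(1)[OF hilbert_carrier(1) None, of "()"] by blast
next
  case (Some B)
  note B = mat_inverse(2)[OF hilbert_carrier(1) Some]
  have "B = (hilbert_inv_mat \<alpha> n * hilbert \<alpha> n) * B"
    using B hilbert_inv_mult[OF assms] left_mult_one_mat[of B "n + 1" "n + 1"] by simp
  also have "\<dots> = hilbert_inv_mat \<alpha> n * (hilbert \<alpha> n * B)"
    using B by (intro assoc_mult_mat[OF hilbert_carrier(2) hilbert_carrier(1)]) blast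
  also have "\<dots> = hilbert_inv_mat \<alpha> n"
    using B right_mult_one_mat[OF hilbert_carrier(2)] by simp
  finally show ?thesis using Some by simp
qed

section \<open>The determinant\<close>

lemma det_hilbert_Suc:
  assumes "1 \<le> \<alpha>"
  shows "det (hilbert \<alpha> (Suc n)) * hilbert_inv \<alpha> (Suc n) (Suc n) (Suc n) = det (hilbert \<alpha> n)"
proof -
  let ?H = "hilbert \<alpha> (Suc n)" and ?B = "hilbert_inv_mat \<alpha> (Suc n)"
  note adj = adj_mat[OF hilbert_carrier(1)[of \<alpha> "Suc n"]]
  \<comment> \<open>Multiplying \<open>?H * adj_mat ?H = det ?H \<cdot>\<^sub>m 1\<^sub>m (Suc n +
    1)\<close> by the inverse from the left avoids any division by the determinant.\<close>
  have "adj_mat ?H = (?B * ?H) * adj_mat ?H"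
    using adj(1) hilbert_inv_mult[OF assms] by simp
  also have "\<dots> = ?B * (?H * adj_mat ?H)"
    by (rule assoc_mult_mat[OF hilbert_carrier(2) hilbert_carrier(1) adj(1)])
  also have "\<dots> = det ?H \<cdot>\<^sub>m ?B"
    unfolding adj(2) using mult_smult_distrib[OF hilbert_carrier(2) one_carrier_mat]
      right_mult_one_mat[OF hilbert_carrier(2)] by simp
  finally have "adj_mat ?H $$ (Suc n, Suc n) = det ?H * hilbert_inv \<alpha> (Suc n) (Suc n) (Suc n)"
    by (simp add: hilbert_inv_mat_def)
  \<comment> \<open>Entries do not depend on the size of the matrix, so removing the last row and
    column gives the smaller Hilbert matrix. The cofactor sign on the diagonal is
    \<open>1\<close>.\<close>
  moreover have "mat_delete ?H (Suc n) (Suc n) = hilbert \<alpha> n"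
    by (rule eq_matI) (auto simp: mat_delete_def hilbert_def)
  then have "adj_mat ?H $$ (Suc n, Suc n) = det (hilbert \<alpha> n)"
    by (simp add: adj_mat_def cofactor_def) (simp add: hilbert_def)
  ultimately show ?thesis by simp
qed

text \<open>On this entry the first two binomials have lower index \<open>0\<close>, and the last
  two coincide.\<close>

lemma hilbert_inv_diag:
  "hilbert_inv \<alpha> n n n = qn (int (2 * n + \<alpha>)) * (qbinom (2 * n + \<alpha> - 1) n)\<^sup>2 / qn (int \<alpha>)"
proof -
  have "qbinom m 0 = 1" for m by (simp add: qbinom_def)
  then show ?thesis
    unfolding hilbert_inv_def mult_2 by (simp add: power2_eq_square del: of_nat_add)
qed

lemma det_hilbert:
  assumes "1 \<le> \<alpha>"
  shows "det (hilbert \<alpha> n) = qn (int \<alpha>) ^ n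
     * inverse (\<Prod>k=1..n. qn (int (2 * k + \<alpha>)) * (qbinom (2 * k + \<alpha> - 1) k)\<^sup>2)"
proof (induction n)
  case 0
  have "qn (int \<alpha>) \<noteq> 0" using assms by (intro qn_nz) simp
  then show ?case by (simp add: hilbert_def det_single)
next
  case (Suc n)
  \<comment> \<open>\<open>c (Suc n) / qn (int \<alpha>)\<close> is the last diagonal entry of the
    inverse. It is nonzero, so the recursion can be solved for the larger determinant.\<close>
  define c where "c k = qn (int (2 * k + \<alpha>)) * (qbinom (2 * k + \<alpha> - 1) k)\<^sup>2" for k
  have "qn (int (2 * Suc n + \<alpha>)) \<noteq> 0" by (intro qn_nz) simp
  moreover have "qbinom (2 * Suc n + \<alpha> - 1) (Suc n) \<noteq> 0"
    using qfact_nz by (subst qbinom_eq_qfact) auto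
  ultimately have "c (Suc n) \<noteq> 0" by (simp only: c_def) simp
  moreover have "qn (int \<alpha>) \<noteq> 0" using assms by (intro qn_nz) simp
  moreover have "det (hilbert \<alpha> (Suc n)) * (c (Suc n) / qn (int \<alpha>)) = det (hilbert \<alpha> n)"
    using det_hilbert_Suc[OF assms, of n] by (simp only: hilbert_inv_diag c_def)
  ultimately have "det (hilbert \<alpha> (Suc n)) = det (hilbert \<alpha> n) * (qn (int \<alpha>) / c (Suc n))"
    by (simp add: field_simps)
  also have "\<dots> = qn (int \<alpha>) ^ Suc n * inverse (\<Prod>k=1..Suc n. c k)"
    unfolding Suc.IH c_def[symmetric] by (simp add: divide_inverse)
  finally show ?case unfolding c_def .
qed

end

section \<open>Specialization to the principal square root of \<open>q\<close>\<close>

theorem theorem2p1: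
  fixes q :: complex and \<alpha> n :: nat
  assumes "0 < cmod q" and "cmod q < 1" and "1 \<le> \<alpha>"
  shows "invertible_mat (quantum_hilbert_mat q \<alpha> n)
    \<and> mat_inverse (quantum_hilbert_mat q \<alpha> n) =
        Some (mat (n + 1) (n + 1) (\<lambda>(l, j).
          (-1) ^ (l + j) * (quantum_int q (l + j + \<alpha>) / quantum_int q \<alpha>)
          * quantum_binomial q (n + l + \<alpha>) (n - j)
          * quantum_binomial q (n + j + \<alpha>) (n - l)
          * quantum_binomial q (l + j + \<alpha> - 1) l
          * quantum_binomial q (l + j + \<alpha> - 1) j))
    \<and> det (quantum_hilbert_mat q \<alpha> n) =
        quantum_int q \<alpha> ^ n
        * inverse (\<Prod>k=1..n. quantum_int q (2 * k + \<alpha>) * (quantum_binomial q (2 * k + \<alpha> - 1) k)\<^sup>2)"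
proof -
  \<comment> \<open>The square root also has modulus below \<open>1\<close>, so none of its positive
    powers equals \<open>1\<close>.\<close>
  have "cmod (csqrt q) ^ 2 = cmod q" by (metis norm_power power2_csqrt)
  then have "cmod (csqrt q) < 1"
    using assms(2) by (metis norm_ge_zero one_le_power not_le)
  then have lt1: "cmod (csqrt q ^ m) < 1" if "m > 0" for m
    using that by (simp add: norm_power power_less_one_iff)
  interpret quantum_base "csqrt q"
  proof
    show "csqrt q \<noteq> 0" using assms(1) by auto
    show "csqrt q ^ m \<noteq> 1" if "m > 0" for m using lt1[OF that] by auto
  qed
  \<comment> \<open>This selects the quotient branch of \<open>quantum_int\<close>, which is
    \<open>qn\<close> at \<open>s = csqrt q\<close>.\<close>
  have "q \<noteq> 1" using assms(2) by auto
  then have q_int: "quantum_int q m = qn (int m)" for m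
    by (simp add: quantum_int_def qn_def power_int_minus power_inverse)
  have q_binom: "quantum_binomial q m k = qbinom m k" for m k
    by (simp add: quantum_binomial_def qbinom_def q_int del: of_nat_add)
  have H: "quantum_hilbert_mat q \<alpha> n = hilbert \<alpha> n"
    by (simp add: quantum_hilbert_mat_def hilbert_def q_int)
  show ?thesis
    unfolding H q_int q_binom
    using hilbert_invertible[OF assms(3)] mat_inverse_hilbert[OF assms(3)] det_hilbert[OF assms(3)]
    by (simp add: hilbert_inv_mat_def hilbert_inv_def)
qed

end
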